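(* Let $m,d$ be positive integers and let $\tau=\{(d_1,\lambda_1),\ldots,(d_t,\lambda_t)\}$ be a similarity class type of size $md$ (i.e. the type of some linear operator on an $md$-dimensional $\mathbb{F}_q$-space). If $\sum_{i=1}^t d_i\lambda_{i,m}=d$, then $$\sigma(m,d;\tau)=\frac{q^{m^2d}}{\gamma_q(m)}\prod_{i=1}^t\prod_{j=1}^m\left(1-q^{-jd_i}\right).$$
   Context: For a linear operator $T$ on a finite-dimensional $\mathbb{F}_q$-space $V$, viewing $V$ as an $\mathbb{F}_q[x]$-module via $x\cdot v=Tv$, one has $V\simeq\bigoplus_{i=1}^t\bigoplus_{j}\mathbb{F}_q[x]/(\phi_i^{\lambda_{i,j}})$ with $\phi_i$ distinct monic irreducibles and $\lambda_i=(\lambda_{i,1}\ge\lambda_{i,2}\ge\cdots)$ partitions; with $d_i=\deg\phi_i$, the multiset $\{(d_1,\lambda_1),\ldots,(d_t,\lambda_t)\}$ is the similarity class type of $T$, and its size is $\dim V$. Here $\lambda_{i,m}$ denotes the $m$-th part of $\lambda_i$ (taken to be $0$ if $\lambda_i$ has fewer than $m$ parts). For $T$ on an $md$-dimensional space, an $m$-dimensional subspace $W$ is $T$-splitting if $V=W\oplus TW\oplus\cdots\oplus T^{d-1}W$; the number of such subspaces depends only on the type $\tau$ of $T$ and is denoted $\sigma(m,d;\tau)$. $\gamma_q(m)=\prod_{i=0}^{m-1}(q^m-q^i)$. *)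

theory Defs
  imports "HOL-Computational_Algebra.Computational_Algebra" "HOL-Library.Multiset" "HOL-Library.FuncSet"
begin

text \<open>
  A vector space over the field \<open>'a\<close> is given by its scalar multiplication
  \<open>scale :: 'a \<Rightarrow> 'b \<Rightarrow> 'b\<close>, as in the locale \<open>vector_space\<close>; the space itself is the whole type \<open>'b\<close>.
\<close>

definition poly_act ::
    "('a::field \<Rightarrow> 'b::ab_group_add \<Rightarrow> 'b) \<Rightarrow> ('b \<Rightarrow> 'b) \<Rightarrow> 'a poly \<Rightarrow> 'b \<Rightarrow> 'b" where
  "poly_act scale T p v = (\<Sum>k\<le>degree p. scale (coeff p k) ((T ^^ k) v))"

text \<open>
  The quotient \<open>F[x]/(g)\<close> is represented by the canonical residues modulo \<open>g\<close>, with all operations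
  reduced modulo \<open>g\<close>. The index sets used are finite, so that the direct sum is the product.
\<close>

definition residues_mod :: "'a::field poly \<Rightarrow> 'a poly set" where
  "residues_mod g = {r. r mod g = r}"

definition poly_module_iso_direct_sum ::
    "('a::field \<Rightarrow> 'b::ab_group_add \<Rightarrow> 'b) \<Rightarrow> ('b \<Rightarrow> 'b) \<Rightarrow> 'i set \<Rightarrow> ('i \<Rightarrow> 'a poly) \<Rightarrow> bool" where
  "poly_module_iso_direct_sum scale T I g \<longleftrightarrow>
     finite I \<and>
     (\<exists>\<psi>. bij_betw \<psi> UNIV (\<Pi>\<^sub>E i\<in>I. residues_mod (g i)) \<and>
          (\<forall>u v. \<forall>i\<in>I. \<psi> (u + v) i = (\<psi> u i + \<psi> v i) mod g i) \<and>
          (\<forall>p v. \<forall>i\<in>I. \<psi> (poly_act scale T p v) i = (p * \<psi> v i) mod g i))"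

definition is_partition :: "nat list \<Rightarrow> bool" where
  "is_partition lam \<longleftrightarrow> sorted_wrt (\<ge>) lam \<and> 0 \<notin> set lam"

text \<open>Parts are numbered from 1, and are 0 beyond the length.\<close>

definition part :: "nat list \<Rightarrow> nat \<Rightarrow> nat" where
  "part lam j = (if 1 \<le> j \<and> j \<le> length lam then lam ! (j - 1) else 0)"

text \<open>
  The partitions in a similarity class type are nonempty: an empty one would contribute a pair
  \<open>(deg \<phi>, [])\<close> for an irreducible \<open>\<phi>\<close> unrelated to \<open>T\<close>, and the type would not be determined by \<open>T\<close>.
\<close>

definition has_similarity_class_type ::
    "('a::field \<Rightarrow> 'b::ab_group_add \<Rightarrow> 'b) \<Rightarrow> ('b \<Rightarrow> 'b) \<Rightarrow> (nat \<times> nat list) multiset \<Rightarrow> bool" where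
  "has_similarity_class_type scale T \<tau> \<longleftrightarrow>
     (\<exists>(t::nat) \<phi> lam.
        (\<forall>i\<in>{1..t}. irreducible (\<phi> i) \<and> lead_coeff (\<phi> i) = 1) \<and>
        inj_on \<phi> {1..t} \<and>
        (\<forall>i\<in>{1..t}. is_partition (lam i) \<and> lam i \<noteq> []) \<and>
        poly_module_iso_direct_sum scale T
          (SIGMA i:{1..t}. {1..length (lam i)}) (\<lambda>(i, j). \<phi> i ^ part (lam i) j) \<and>
        \<tau> = image_mset (\<lambda>i. (degree (\<phi> i), lam i)) (mset_set {1..t}))"

definition splitting_subspace ::
    "('a::field \<Rightarrow> 'b::ab_group_add \<Rightarrow> 'b) \<Rightarrow> ('b \<Rightarrow> 'b) \<Rightarrow> nat \<Rightarrow> nat \<Rightarrow> 'b set \<Rightarrow> bool" where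
  "splitting_subspace scale T m d W \<longleftrightarrow>
     module.subspace scale W \<and> vector_space.dim scale W = m \<and>
     (\<forall>v. \<exists>!w. w \<in> (\<Pi>\<^sub>E i\<in>{..<d}. (T ^^ i) ` W) \<and> v = (\<Sum>i<d. w i))"

definition num_splitting_subspaces ::
    "('a::field \<Rightarrow> 'b::ab_group_add \<Rightarrow> 'b) \<Rightarrow> ('b \<Rightarrow> 'b) \<Rightarrow> nat \<Rightarrow> nat \<Rightarrow> nat" where
  "num_splitting_subspaces scale T m d = card {W. splitting_subspace scale T m d W}"

definition gamma_q :: "real \<Rightarrow> nat \<Rightarrow> real" where
  "gamma_q q m = (\<Prod>i<m. q ^ m - q ^ i)"

end

theory Submission
  imports Defs
begin

text \<open>
  The parts satisfy \<open>\<lambda>\<^sub>i\<^sub>,\<^sub>1 \<ge> \<lambda>\<^sub>i\<^sub>,\<^sub>2 \<ge> \<dots>\<close>, so the size \<open>m d\<close> together with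
  \<open>\<Sum> d\<^sub>i \<lambda>\<^sub>i\<^sub>,\<^sub>m = d\<close> forces each \<open>\<lambda>\<^sub>i\<close> to consist of \<open>m\<close> equal parts \<open>e\<^sub>i\<close>. Hence \<open>V\<close> is free of
  rank \<open>m\<close> over \<open>F[x]/(p)\<close>, where \<open>p = \<Prod> \<phi>\<^sub>i ^ e\<^sub>i\<close> has degree \<open>d\<close>. Division by \<open>p\<close> shows that the ordered
  bases of splitting subspaces are exactly the \<open>m\<close>-tuples generating \<open>V\<close> as an \<open>F[x]\<close>-module, and each
  splitting subspace has \<open>\<gamma>\<^sub>q(m)\<close> ordered bases. By Nakayama's lemma a tuple generates \<open>V\<close> if and only
  if for every \<open>i\<close> it generates \<open>V/\<phi>\<^sub>iV\<close>, which has dimension \<open>m\<close> over a field with \<open>q ^ d\<^sub>i\<close> elements,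
  that is, if each entry avoids, modulo every \<open>\<phi>\<^sub>i\<close>, the span of the entries chosen before it. By the
  Chinese remainder theorem these conditions are independent for different \<open>i\<close>, so after \<open>k\<close> entries
  there are \<open>|V| \<Prod> (1 - q ^ (d\<^sub>i (k - m)))\<close> choices for the next one.
\<close>

subsection \<open>Counting principles\<close>

text \<open>An admissible list of length \<open>Suc n\<close> consists of exactly one admissible
  tail and one head drawn from \<open>E\<close> of that tail, so the counts multiply. Lists grow at
  the front: the head is the entry chosen last.\<close>

lemma card_lists_extension:
  assumes "P []" and "\<And>x xs. P (x # xs) \<longleftrightarrow> P xs \<and> x \<in> E xs"
    and "\<And>xs. finite (E xs)"
    and "\<And>xs. P xs \<Longrightarrow> length xs < n \<Longrightarrow> real (card (E xs)) = c (length xs)"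
  shows "finite {xs. P xs \<and> length xs = n} \<and> real (card {xs. P xs \<and> length xs = n}) = (\<Prod>k<n. c k)"
  using assms(4)
proof (induction n)
  case 0
  have "{xs. P xs \<and> length xs = 0} = {[]}"
    using assms(1) by auto
  then show ?case by simp
next
  case (Suc n)
  let ?A = "{xs. P xs \<and> length xs = n}"
  have IH: "finite ?A" "real (card ?A) = (\<Prod>k<n. c k)"
    using Suc.IH Suc.prems by auto
  have eq: "{xs. P xs \<and> length xs = Suc n} = (\<lambda>(xs, x). x # xs) ` (SIGMA xs:?A. E xs)"
    by (auto simp: length_Suc_conv assms(2))
  have inj: "inj_on (\<lambda>(xs, x). x # xs) (SIGMA xs:?A. E xs)"
    by (auto simp: inj_on_def)
  have "card {xs. P xs \<and> length xs = Suc n} = (\<Sum>xs\<in>?A. card (E xs))"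
    unfolding eq card_image[OF inj] using IH(1) assms(3) by simp
  also have "real \<dots> = (\<Sum>xs\<in>?A. c n)"
    using Suc.prems by simp
  also have "\<dots> = (\<Prod>k<Suc n. c k)"
    using IH(2) by simp
  finally show ?case
    unfolding eq using IH(1) assms(3) by auto
qed

text \<open>With \<open>X\<close> invariant under \<open>H\<close> and \<open>H + S = V\<close>, membership in \<open>X\<close> and in \<open>S\<close> are independent
  events.\<close>

lemma card_inter_times_card_UNIV:
  fixes S H X :: "'b::ab_group_add set"
  assumes fin: "finite (UNIV :: 'b set)"
    and S: "\<And>x y. x \<in> S \<Longrightarrow> y \<in> S \<Longrightarrow> x + y \<in> S" "\<And>x. x \<in> S \<Longrightarrow> - x \<in> S"
    and H: "\<And>x. x \<in> H \<Longrightarrow> - x \<in> H"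
    and X: "\<And>x h. x \<in> X \<Longrightarrow> h \<in> H \<Longrightarrow> x + h \<in> X"
    and sum: "\<And>v. \<exists>h\<in>H. \<exists>s\<in>S. v = h + s"
  shows "card (X \<inter> S) * card (UNIV :: 'b set) = card X * card S"
proof -
  have finite: "finite A" for A :: "'b set"
    by (rule finite_subset[OF subset_UNIV fin])
  \<comment> \<open>Every coset of \<open>S\<close> meets \<open>X\<close> in equally many points:
    \<open>v\<close> and \<open>h\<close> lie in the same coset, and translation by \<open>h\<close>
    or \<open>- h\<close> preserves \<open>X\<close>.\<close>
  have translate: "card {x \<in> X. x - v \<in> S} = card (X \<inter> S)" for v
  proof -
    obtain h s where hs: "h \<in> H" "s \<in> S" "v = h + s"
      using sum by blast
    have "bij_betw (\<lambda>x. x + h) (X \<inter> S) {x \<in> X. x - v \<in> S}"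
    proof (rule bij_betwI[where g = "\<lambda>x. x + - h"])
      show "(\<lambda>x. x + h) \<in> X \<inter> S \<rightarrow> {x \<in> X. x - v \<in> S}"
      proof
        fix x assume x: "x \<in> X \<inter> S"
        then have "x + - s \<in> S"
          using S hs by blast
        then show "x + h \<in> {x \<in> X. x - v \<in> S}"
          using x hs X by simp
      qed
      show "(\<lambda>x. x + - h) \<in> {x \<in> X. x - v \<in> S} \<rightarrow> X \<inter> S"
      proof
        fix x assume x: "x \<in> {x \<in> X. x - v \<in> S}"
        then have "x - v + s \<in> S"
          using S(1) hs by blast
        then show "x + - h \<in> X \<inter> S"
          using x hs H X[of x "- h"] by simp
      qed
    qed auto
    then show ?thesis
      by (simp add: bij_betw_same_card)
  qed
  have fibre: "card {v. x - v \<in> S} = card S" for x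
    by (rule bij_betw_same_card[OF bij_betwI[where f = "\<lambda>v. x - v" and g = "\<lambda>v. x - v"]]) auto
  txt \<open>Count the pairs \<open>(v, x)\<close> with \<open>x \<in> X \<inter> (v + S)\<close> in two ways.\<close>
  have "card (X \<inter> S) * card (UNIV :: 'b set) = (\<Sum>v\<in>UNIV. card {x \<in> X. x - v \<in> S})"
    by (simp add: translate)
  also have "\<dots> = (\<Sum>v\<in>UNIV. \<Sum>x\<in>X. if x - v \<in> S then 1 else 0)"
    by (intro sum.cong) (simp_all add: finite flip: sum.inter_filter)
  also have "\<dots> = (\<Sum>x\<in>X. \<Sum>v\<in>UNIV. if x - v \<in> S then 1 else 0)"
    by (rule sum.swap)
  also have "\<dots> = (\<Sum>x\<in>X. card {v. x - v \<in> S})"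
    by (intro sum.cong) (simp_all add: finite flip: sum.inter_filter)
  finally show ?thesis
    by (simp add: fibre)
qed

text \<open>The nonempty fibres are translates of the kernel and partition the space. This later
  turns the size of the \<phi>-torsion into the size of \<open>\<phi>V\<close>.\<close>

lemma card_kernel_times_card_range:
  fixes f :: "'b::ab_group_add \<Rightarrow> 'b"
  assumes fin: "finite (UNIV :: 'b set)" and add: "\<And>x y. f (x + y) = f x + f y"
  shows "card {v. f v = 0} * card (range f) = card (UNIV :: 'b set)"
proof -
  have diff: "f (x - y) = f x - f y" for x y
    using add[of "x - y" y] by simp
  have fibre: "card {v. f v = y} = card {v. f v = 0}" if y: "y \<in> range f" for y
  proof -
    obtain u where u: "y = f u" using y by blast
    show ?thesis
      by (rule bij_betw_same_card[OF bij_betwI[where f = "\<lambda>v. v - u" and g = "\<lambda>v. v + u"]])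
        (auto simp: u add diff)
  qed
  have "card (UNIV :: 'b set) = card (\<Union>y\<in>range f. {v. f v = y})"
    by (rule arg_cong[where f = card]) auto
  also have "\<dots> = (\<Sum>y\<in>range f. card {v. f v = y})"
    using fin by (intro card_UN_disjoint) (auto intro: finite_subset)
  also have "\<dots> = (\<Sum>y\<in>range f. card {v. f v = 0})"
    using fibre by (rule sum.cong[OF refl])
  finally show ?thesis by simp
qed

subsection \<open>Polynomials over a field\<close>

text \<open>A nonzero element \<open>g\<close> of least degree in the ideal generated by \<phi> and
  \<open>f\<close> divides both. It is not associated to \<phi>, which does not divide
  \<open>f\<close>, so irreducibility makes it a unit.\<close>

lemma irreducible_bezout:
  fixes \<phi> f :: "'a::field poly"
  assumes irr: "irreducible \<phi>" and ndvd: "\<not> \<phi> dvd f"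
  shows "\<exists>a b. a * \<phi> + b * f = 1"
proof -
  let ?J = "{a * \<phi> + b * f | a b. True}"
  have \<phi>J: "\<phi> \<in> ?J"
    by (rule CollectI, rule exI[of _ 1], rule exI[of _ 0]) simp
  have fJ: "f \<in> ?J"
    by (rule CollectI, rule exI[of _ 0], rule exI[of _ 1]) simp
  have "\<phi> \<noteq> 0" using irr by auto
  then obtain g where g: "g \<in> ?J" "g \<noteq> 0" and min: "\<And>h. h \<in> ?J \<Longrightarrow> h \<noteq> 0 \<Longrightarrow> degree g \<le> degree h"
    using \<phi>J ex_has_least_nat[of "\<lambda>h. h \<in> ?J \<and> h \<noteq> 0" \<phi> degree] by blast
  obtain a b where ab: "g = a * \<phi> + b * f" using g by blast
  have dvd: "g dvd h" if h: "h \<in> ?J" for h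
  proof (rule ccontr)
    assume "\<not> g dvd h"
    then have nz: "h mod g \<noteq> 0" by (simp add: dvd_eq_mod_eq_0)
    obtain a' b' where h': "h = a' * \<phi> + b' * f" using h by blast
    have "h mod g = (a' - h div g * a) * \<phi> + (b' - h div g * b) * f"
    proof -
      have "h mod g = (a' * \<phi> + b' * f) - h div g * (a * \<phi> + b * f)"
        using minus_div_mult_eq_mod[of h g] ab h' by metis
      then show ?thesis by (simp only: algebra_simps)
    qed
    then have "h mod g \<in> ?J" by blast
    then have "degree g \<le> degree (h mod g)" using min nz by blast
    then show False using degree_mod_less[OF g(2), of h] nz by simp
  qed
  obtain k where k: "\<phi> = g * k" using dvd[OF \<phi>J] by (elim dvdE)
  have "\<not> is_unit k"
  proof
    assume "is_unit k"
    then have "\<phi> dvd g" by (simp add: k)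
    then show False using dvd[OF fJ] ndvd dvd_trans by blast
  qed
  then have "is_unit g" using irreducibleD[OF irr k] by blast
  then obtain u where "1 = g * u" by (elim dvdE)
  then have "u * a * \<phi> + u * b * f = 1" unfolding ab by (simp add: algebra_simps)
  then show ?thesis by blast
qed

text \<open>In the product of the two identities every term except \<open>(b * b') * (f * g)\<close>
  is a multiple of \<phi>.\<close>

lemma bezout_mult:
  fixes \<phi> :: "'a::comm_ring_1"
  assumes "\<exists>a b. a * \<phi> + b * f = 1" and "\<exists>a b. a * \<phi> + b * g = 1"
  shows "\<exists>a b. a * \<phi> + b * (f * g) = 1"
proof -
  obtain a b a' b' where "a * \<phi> + b * f = 1" "a' * \<phi> + b' * g = 1"
    using assms by blast
  then have "(a * \<phi> + b * f) * (a' * \<phi> + b' * g) = 1" by simp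
  then have "(a * a' * \<phi> + a * b' * g + b * f * a') * \<phi> + (b * b') * (f * g) = 1"
    by (simp add: algebra_simps)
  then show ?thesis by blast
qed

lemma bezout_prod:
  fixes \<phi> :: "'a::comm_ring_1"
  assumes "\<And>i. i \<in> I \<Longrightarrow> \<exists>a b. a * \<phi> + b * f i = 1"
  shows "\<exists>a b. a * \<phi> + b * (\<Prod>i\<in>I. f i) = 1"
  using assms
proof (induction I rule: infinite_finite_induct)
  case (insert i I)
  then show ?case by (simp add: bezout_mult)
qed (auto intro: exI[of _ 0] exI[of _ 1])

lemma bezout_power:
  fixes \<phi> :: "'a::comm_ring_1"
  assumes "\<exists>a b. a * \<phi> + b * f = 1"
  shows "\<exists>a b. a * \<phi> + b * f ^ n = 1"
  using bezout_prod[of "{..<n}" \<phi> "\<lambda>_. f", OF assms] by simp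

lemma residues_mod_iff:
  fixes g :: "'a::field poly"
  assumes "g \<noteq> 0"
  shows "r \<in> residues_mod g \<longleftrightarrow> r = 0 \<or> degree r < degree g"
proof
  assume "r \<in> residues_mod g"
  then show "r = 0 \<or> degree r < degree g"
    using degree_mod_less[OF assms, of r] by (simp add: residues_mod_def)
qed (auto simp: residues_mod_def mod_poly_less)

text \<open>Peeling off the constant coefficient with \<open>pCons\<close> gives one factor per
  step. Bounding the coefficients rather than the degree covers the zero polynomial without a
  separate case.\<close>

lemma card_coeff_bounded:
  "finite {p :: 'a::{field,finite} poly. \<forall>k\<ge>n. coeff p k = 0} \<and>
   card {p :: 'a poly. \<forall>k\<ge>n. coeff p k = 0} = card (UNIV :: 'a set) ^ n"
proof (induction n)
  case 0
  have "{p :: 'a poly. \<forall>k\<ge>0. coeff p k = 0} = {0}"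
    by (auto simp: poly_eq_iff)
  then show ?case by simp
next
  case (Suc n)
  let ?A = "{p :: 'a poly. \<forall>k\<ge>n. coeff p k = 0}"
  have "p \<in> (\<lambda>(a, p). pCons a p) ` (UNIV \<times> ?A)" if "\<forall>k\<ge>Suc n. coeff p k = 0" for p :: "'a poly"
    using that by (cases p) (force simp: coeff_pCons_Suc dest: spec[of _ "Suc _"])
  then have eq: "{p :: 'a poly. \<forall>k\<ge>Suc n. coeff p k = 0} = (\<lambda>(a, p). pCons a p) ` (UNIV \<times> ?A)"
    by (auto simp: coeff_pCons split: nat.split)
  have inj: "inj_on (\<lambda>(a, p). pCons a p) (UNIV \<times> ?A)"
    by (auto simp: inj_on_def)
  show ?case
    unfolding eq card_image[OF inj] using Suc by (simp add: card_cartesian_product)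
qed

lemma
  fixes g :: "'a::{field,finite} poly"
  assumes "g \<noteq> 0"
  shows finite_residues_mod: "finite (residues_mod g)"
    and card_residues_mod: "card (residues_mod g) = card (UNIV :: 'a set) ^ degree g"
proof -
  have "(r = 0 \<or> degree r < degree g) \<longleftrightarrow> (\<forall>k\<ge>degree g. coeff r k = 0)" for r :: "'a poly"
    by (metis coeff_0 coeff_eq_0 leading_coeff_0_iff linorder_not_less order_less_le_trans)
  then have "residues_mod g = {p. \<forall>k\<ge>degree g. coeff p k = 0}"
    using residues_mod_iff[OF assms] by blast
  then show "finite (residues_mod g)" "card (residues_mod g) = card (UNIV :: 'a set) ^ degree g"
    using card_coeff_bounded by auto
qed

text \<open>The elements killed by \<phi> are the multiples of \<open>\<phi> ^ e\<close>, and
  division by \<open>\<phi> ^ e\<close> leaves an arbitrary residue modulo \<phi>, whatever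
  \<open>e\<close> is. The exponent is a successor because the module for exponent 0 is
  zero.\<close>

lemma card_residues_mod_torsion:
  fixes \<phi> :: "'a::{field,finite} poly"
  assumes nz: "\<phi> \<noteq> 0"
  shows "card {r \<in> residues_mod (\<phi> ^ Suc e). \<phi> ^ Suc e dvd \<phi> * r} = card (UNIV :: 'a set) ^ degree \<phi>"
proof -
  have "{r \<in> residues_mod (\<phi> ^ Suc e). \<phi> ^ Suc e dvd \<phi> * r} = (\<lambda>s. \<phi> ^ e * s) ` residues_mod \<phi>"
  proof (intro equalityI subsetI)
    fix r assume r: "r \<in> {r \<in> residues_mod (\<phi> ^ Suc e). \<phi> ^ Suc e dvd \<phi> * r}"
    then have "\<phi> ^ e dvd r" using nz by simp
    then obtain s where s: "r = \<phi> ^ e * s" by (elim dvdE)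
    have "s = 0 \<or> degree s < degree \<phi>"
      using r nz by (cases "s = 0") (simp_all add: s residues_mod_iff degree_mult_eq)
    then show "r \<in> (\<lambda>s. \<phi> ^ e * s) ` residues_mod \<phi>"
      using s nz by (auto simp: residues_mod_iff)
  next
    fix r assume "r \<in> (\<lambda>s. \<phi> ^ e * s) ` residues_mod \<phi>"
    then obtain s where s: "r = \<phi> ^ e * s" "s = 0 \<or> degree s < degree \<phi>"
      using nz by (auto simp: residues_mod_iff)
    then show "r \<in> {r \<in> residues_mod (\<phi> ^ Suc e). \<phi> ^ Suc e dvd \<phi> * r}"
      using nz by (cases "s = 0") (simp_all add: residues_mod_iff degree_mult_eq)
  qed
  moreover have "inj_on (\<lambda>s. \<phi> ^ e * s) (residues_mod \<phi>)"
    using nz by (auto simp: inj_on_def)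
  ultimately show ?thesis
    by (simp add: card_image card_residues_mod[OF nz])
qed

text \<open>If \<phi> divided \<chi>, the cofactor would be a unit, hence constant, and comparing
  leading coefficients would make it 1.\<close>

lemma monic_irreducible_bezout:
  fixes \<phi> \<chi> :: "'a::field poly"
  assumes "irreducible \<phi>" "irreducible \<chi>" "lead_coeff \<phi> = 1" "lead_coeff \<chi> = 1" "\<phi> \<noteq> \<chi>"
  shows "\<exists>a b. a * \<phi> + b * \<chi> = 1"
proof (rule irreducible_bezout[OF assms(1)])
  show "\<not> \<phi> dvd \<chi>"
  proof
    assume dvd: "\<phi> dvd \<chi>"
    then obtain k where k: "\<chi> = \<phi> * k" by (elim dvdE)
    have "\<not> is_unit \<phi>" using assms(1) irreducible_not_unit by blast
    then have "is_unit k" using irreducibleD[OF assms(2) k] by blast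
    then obtain c where "k = [:c:]" by (auto simp: is_unit_poly_iff)
    moreover have "lead_coeff k = 1" using assms(3,4) by (simp add: k lead_coeff_mult)
    ultimately have "k = 1" by (simp add: one_pCons)
    then show False using assms(5) k by simp
  qed
qed

text \<open>Modulo \<open>g\<close> the polynomial \<phi> is invertible with inverse
  \<open>a\<close>, so multiplication by it kills only 0.\<close>

lemma residues_mod_torsion_coprime:
  fixes \<phi> g :: "'a::field poly"
  assumes "\<exists>a b. a * \<phi> + b * g = 1"
  shows "{r \<in> residues_mod g. g dvd \<phi> * r} = {0}"
proof -
  obtain a b where ab: "a * \<phi> + b * g = 1" using assms by blast
  have "r = 0" if r: "r mod g = r" "g dvd \<phi> * r" for r
  proof -
    have "r = (a * \<phi> + b * g) * r" by (simp add: ab)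
    also have "\<dots> = a * (\<phi> * r) + g * (b * r)" by (simp add: algebra_simps)
    finally have "g dvd r" using r(2) by (metis dvd_add dvd_mult dvd_triv_left)
    then show ?thesis using r(1) by (simp add: dvd_eq_mod_eq_0)
  qed
  then show ?thesis by (auto simp: residues_mod_def)
qed

subsection \<open>Partitions\<close>

lemma part_antimono:
  assumes "is_partition lam" "1 \<le> i" "i \<le> j"
  shows "part lam j \<le> part lam i"
proof (cases "i = j \<or> length lam < j")
  case False
  then have "lam ! (i - 1) \<ge> lam ! (j - 1)"
    using assms sorted_wrt_nth_less[of "(\<ge>)" lam "i - 1" "j - 1"] by (auto simp: is_partition_def)
  then show ?thesis using assms False by (simp add: part_def)
qed (auto simp: part_def)

lemma part_pos:
  assumes "is_partition lam" "1 \<le> j" "j \<le> length lam"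
  shows "0 < part lam j"
proof -
  have "lam ! (j - 1) \<in> set lam" using assms by (intro nth_mem) auto
  then have "lam ! (j - 1) \<noteq> 0" using assms(1) unfolding is_partition_def by metis
  then show ?thesis using assms(2,3) by (simp add: part_def)
qed

text \<open>Each of the first \<open>m\<close> parts is at least the \<open>m\<close>-th. Equality
  leaves nothing for parts beyond the \<open>m\<close>-th, and since parts are positive there are
  none.\<close>

lemma sum_parts_ge:
  assumes lam: "is_partition lam" "lam \<noteq> []" and m: "1 \<le> m"
  shows "m * part lam m \<le> (\<Sum>j=1..length lam. part lam j)"
    and "m * part lam m = (\<Sum>j=1..length lam. part lam j) \<Longrightarrow>
      length lam = m \<and> (\<forall>j\<in>{1..m}. part lam j = part lam m)"
proof -
  let ?s = "\<Sum>j=1..length lam. part lam j"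
  have "m * part lam m \<le> ?s \<and> (m * part lam m = ?s \<longrightarrow>
      length lam = m \<and> (\<forall>j\<in>{1..m}. part lam j = part lam m))"
  proof (cases "length lam < m")
    \<comment> \<open>Equality is impossible here: the default value of \<open>part\<close> makes
      the left side 0, while a nonempty partition has a positive sum.\<close>
    case True
    then have "part lam m = 0" by (simp add: part_def)
    moreover have "0 < ?s"
      using lam(2) part_pos[OF lam(1)] by (intro sum_pos) (auto simp: Suc_le_eq)
    ultimately show ?thesis by (metis mult_0_right less_imp_le less_irrefl)
  next
    case False
    have le: "part lam m \<le> part lam j" if "j \<in> {1..m}" for j
      using that part_antimono[OF lam(1)] by simp
    then have 1: "(\<Sum>j=1..m. part lam m) \<le> (\<Sum>j=1..m. part lam j)"
      by (rule sum_mono)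
    have 2: "?s = (\<Sum>j=1..m. part lam j) + (\<Sum>j=m+1..length lam. part lam j)"
      using False m sum.ub_add_nat[of 1 m "part lam" "length lam - m"] by simp
    show ?thesis
    proof (intro conjI impI)
      show "m * part lam m \<le> ?s" using 1 2 by simp
    next
      assume eq: "m * part lam m = ?s"
      have "(\<Sum>j=m+1..length lam. part lam j) = 0"
        using 1 2 eq by simp
      then have zero: "part lam j = 0" if "j \<in> {m+1..length lam}" for j
        using that by (simp only: sum_eq_0_iff finite_atLeastAtMost)
      show "length lam = m"
      proof (rule ccontr)
        assume "length lam \<noteq> m"
        then have "part lam (length lam) = 0"
          using False by (intro zero) simp
        then show False
          using part_pos[OF lam(1), of "length lam"] False m by simp
      qed
      have "(\<Sum>j=1..m. part lam m) = (\<Sum>j=1..m. part lam j)"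
        using 1 2 eq by simp
      then have "part lam m = part lam j" if "j \<in> {1..m}" for j
        by (rule sum_mono_inv[OF _ le that]) simp_all
      then show "\<forall>j\<in>{1..m}. part lam j = part lam m" by metis
    qed
  qed
  then show "m * part lam m \<le> ?s" "m * part lam m = ?s \<Longrightarrow>
      length lam = m \<and> (\<forall>j\<in>{1..m}. part lam j = part lam m)" by blast+
qed

subsection \<open>The module structure given by an operator\<close>

text \<open>Finiteness of the space lets cardinalities replace dimensions, over the base field as
  well as over the residue fields \<open>F[x]/(\<phi>)\<close>.\<close>

locale finite_operator = vector_space scale
  for scale :: "'a::{field,finite} \<Rightarrow> 'b::ab_group_add \<Rightarrow> 'b" +
  fixes T :: "'b \<Rightarrow> 'b"
  assumes linear_T: "Vector_Spaces.linear scale scale T"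
    and finite_space: "finite (UNIV :: 'b set)"
begin

interpretation T: Vector_Spaces.linear scale scale T
  by (fact linear_T)

abbreviation act :: "'a poly \<Rightarrow> 'b \<Rightarrow> 'b" (infixr "\<star>" 75)
  where "act \<equiv> poly_act scale T"

lemma finite_sets [simp]: "finite (A :: 'b set)"
  by (rule finite_subset[OF subset_UNIV finite_space])

lemma power_T_add: "(T ^^ k) (x + y) = (T ^^ k) x + (T ^^ k) y"
  by (induction k) (auto simp: T.add)

lemma power_T_scale: "(T ^^ k) (scale c x) = scale c ((T ^^ k) x)"
  by (induction k) (auto simp: T.scale)

text \<open>Padding with zero coefficients gives the sums for different polynomials a common
  range.\<close>

lemma act_eq:
  assumes "degree p \<le> n"
  shows "p \<star> v = (\<Sum>k\<le>n. scale (coeff p k) ((T ^^ k) v))"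
  unfolding poly_act_def using assms
  by (intro sum.mono_neutral_left) (auto simp: coeff_eq_0)

lemma act_0 [simp]: "0 \<star> v = 0"
  by (simp add: poly_act_def)

lemma act_1 [simp]: "1 \<star> v = v"
  by (simp add: poly_act_def)

lemma act_add_right: "p \<star> (u + v) = p \<star> u + p \<star> v"
  by (simp add: poly_act_def power_T_add scale_right_distrib sum.distrib)

lemma act_zero_right [simp]: "p \<star> 0 = 0"
  using act_add_right[of p 0 0] by simp

lemma act_add: "(p + q) \<star> v = p \<star> v + q \<star> v"
  by (simp add: act_eq[of _ "max (degree p) (degree q)"] degree_add_le_max scale_left_distrib
      sum.distrib)

lemma act_uminus: "(- p) \<star> v = - (p \<star> v)"
  using act_add[of p "- p" v] by (simp add: eq_neg_iff_add_eq_0 add.commute)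

lemma act_diff: "(p - q) \<star> v = p \<star> v - q \<star> v"
  using act_add[of p "- q" v] by (simp add: act_uminus)

lemma act_smult: "smult c p \<star> v = scale c (p \<star> v)"
  by (simp add: act_eq[of _ "degree p"] degree_smult_le scale_sum_right)

text \<open>Horner's rule: it shows that \<open>x\<close> acts as \<open>T\<close> and drives the
  induction for products of polynomials.\<close>

lemma act_pCons: "pCons a p \<star> v = scale a v + T (p \<star> v)"
proof -
  have "pCons a p \<star> v = (\<Sum>k\<le>Suc (degree p). scale (coeff (pCons a p) k) ((T ^^ k) v))"
    by (rule act_eq) (rule degree_pCons_le)
  also have "\<dots> = scale a v + (\<Sum>k\<le>degree p. T (scale (coeff p k) ((T ^^ k) v)))"
    by (subst sum.atMost_Suc_shift) (simp add: T.scale)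
  also have "\<dots> = scale a v + T (p \<star> v)"
    by (simp add: T.sum poly_act_def)
  finally show ?thesis .
qed

lemma act_mult: "(p * q) \<star> v = p \<star> q \<star> v"
  by (induction p) (simp_all add: act_pCons act_add act_smult)

lemma act_commute: "p \<star> q \<star> v = q \<star> p \<star> v"
  by (metis act_mult mult.commute)

lemma act_const: "[:c:] \<star> v = scale c v"
  by (simp add: act_pCons T.zero)

lemma act_X: "[:0, 1:] \<star> v = T v"
  by (simp add: act_pCons T.zero)

section \<open>Submodules and generation by lists\<close>

definition submodule :: "'b set \<Rightarrow> bool"
  where "submodule S \<longleftrightarrow>
    0 \<in> S \<and> (\<forall>x\<in>S. \<forall>y\<in>S. x + y \<in> S) \<and> (\<forall>p. \<forall>x\<in>S. p \<star> x \<in> S)"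

lemma submoduleD:
  assumes "submodule S"
  shows "0 \<in> S" "x \<in> S \<Longrightarrow> y \<in> S \<Longrightarrow> x + y \<in> S" "x \<in> S \<Longrightarrow> p \<star> x \<in> S" "x \<in> S \<Longrightarrow> - x \<in> S"
    "x \<in> S \<Longrightarrow> y \<in> S \<Longrightarrow> x - y \<in> S"
proof -
  show 1: "0 \<in> S" "x \<in> S \<Longrightarrow> y \<in> S \<Longrightarrow> x + y \<in> S" "x \<in> S \<Longrightarrow> p \<star> x \<in> S" for x y p
    using assms by (auto simp: submodule_def)
  show 2: "x \<in> S \<Longrightarrow> - x \<in> S" for x
    using 1(3)[of x "- 1"] by (simp add: act_uminus)
  show "x \<in> S \<Longrightarrow> y \<in> S \<Longrightarrow> x - y \<in> S"
    using 1(2)[OF _ 2] by simp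
qed

lemma submodule_0: "submodule {0}"
  by (simp add: submodule_def)

lemma submodule_range_act: "submodule (range (act p))"
  unfolding submodule_def
proof (intro conjI ballI allI)
  show "0 \<in> range (act p)"
    by (metis act_zero_right rangeI)
  show "x + y \<in> range (act p)" if "x \<in> range (act p)" "y \<in> range (act p)" for x y
    using that by (auto simp flip: act_add_right)
  show "r \<star> x \<in> range (act p)" if "x \<in> range (act p)" for r x
    using that by (auto simp: act_commute[of r])
qed

lemma submodule_imp_subspace: "submodule S \<Longrightarrow> subspace S"
  unfolding subspace_def using submoduleD(1,2) submoduleD(3)[of S _ "[:_:]"]
  by (auto simp: act_const)

text \<open>This is \<open>N\<close> plus the sum of the cyclic submodules of the entries. With
  \<open>N = {0}\<close> it is the submodule generated by the list; with \<open>N = \<phi>V\<close>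
  it is the preimage of the submodule generated in \<open>V/\<phi>V\<close>, so no quotient has to
  be constructed.\<close>

primrec gen :: "'b set \<Rightarrow> 'b list \<Rightarrow> 'b set"
  where
    "gen N [] = N"
  | "gen N (x # xs) = {p \<star> x + y | p y. y \<in> gen N xs}"

lemma gen_Cons_subset: "gen N xs \<subseteq> gen N (x # xs)"
proof
  fix y assume "y \<in> gen N xs"
  then show "y \<in> gen N (x # xs)"
    by (auto intro!: exI[of _ 0] exI[of _ y])
qed

lemma subset_gen: "N \<subseteq> gen N xs"
proof (induction xs)
  case (Cons x xs)
  then show ?case using gen_Cons_subset by blast
qed simp

lemma submodule_gen:
  assumes "submodule N"
  shows "submodule (gen N xs)"
proof (induction xs)
  case (Cons x xs)
  let ?G = "gen N xs"
  have mem: "p \<star> x + y \<in> gen N (x # xs)" if "y \<in> ?G" for p y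
    using that by auto
  show ?case
    unfolding submodule_def
  proof (intro conjI ballI allI)
    show "0 \<in> gen N (x # xs)"
      using mem[of 0 0] submoduleD(1)[OF Cons] by simp
  next
    fix u v assume "u \<in> gen N (x # xs)" "v \<in> gen N (x # xs)"
    then obtain p y r z where "u = p \<star> x + y" "v = r \<star> x + z" "y \<in> ?G" "z \<in> ?G"
      by auto
    then show "u + v \<in> gen N (x # xs)"
      using mem[of "y + z" "p + r"] submoduleD(2)[OF Cons] by (simp add: act_add algebra_simps)
  next
    fix r u assume "u \<in> gen N (x # xs)"
    then obtain p y where "u = p \<star> x + y" "y \<in> ?G"
      by auto
    then show "r \<star> u \<in> gen N (x # xs)"
      using mem[of "r \<star> y" "r * p"] submoduleD(3)[OF Cons] by (simp add: act_mult act_add_right)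
  qed
qed (simp add: assms)

lemma set_subset_gen:
  assumes "submodule N"
  shows "set xs \<subseteq> gen N xs"
proof (induction xs)
  case (Cons x xs)
  have "x = 1 \<star> x + 0"
    by simp
  then have "x \<in> gen N (x # xs)"
    using submoduleD(1)[OF submodule_gen[OF assms]] unfolding gen.simps by blast
  then show ?case using Cons gen_Cons_subset[of N xs x] by auto
qed simp

text \<open>This passes from generation modulo \<open>\<phi>V\<close> to the hypothesis of
  Nakayama's lemma.\<close>

lemma gen_decompose:
  assumes "v \<in> gen N xs"
  shows "\<exists>y\<in>gen {0} xs. \<exists>z\<in>N. v = y + z"
  using assms
proof (induction xs arbitrary: v)
  case (Cons x xs)
  then obtain p u where u: "v = p \<star> x + u" "u \<in> gen N xs"
    by auto
  then obtain y z where "y \<in> gen {0} xs" "z \<in> N" "u = y + z"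
    using Cons.IH by blast
  then show ?case
    using u by (intro bexI[of _ "p \<star> x + y"] bexI[of _ z]) (auto simp: algebra_simps)
qed simp

lemma gen_mono: "N \<subseteq> N' \<Longrightarrow> gen N xs \<subseteq> gen N' xs"
  by (induction xs) auto

text \<open>The property \<open>V = M + gV\<close> is multiplicative in \<open>g\<close>, because
  substituting \<open>V = M + hV\<close> into \<open>gV\<close> gives \<open>V = M + ghV\<close>. It
  therefore holds for the product, which annihilates \<open>V\<close>.\<close>

lemma nakayama:
  assumes M: "submodule M" and f: "\<And>i v. i \<in> I \<Longrightarrow> \<exists>y\<in>M. \<exists>z. v = y + f i \<star> z"
    and fin: "finite I"
    and ann: "\<And>v. (\<Prod>i\<in>I. f i ^ e i) \<star> v = 0"
  shows "M = UNIV"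
proof -
  define Q where "Q g \<longleftrightarrow> (\<forall>v. \<exists>y\<in>M. \<exists>z. v = y + g \<star> z)" for g
  have Q1: "Q 1"
    unfolding Q_def using submoduleD(1)[OF M] by (metis act_1 add_0)
  have Qmult: "Q (g * h)" if g: "Q g" and h: "Q h" for g h
    unfolding Q_def
  proof
    fix v
    obtain y z where y: "y \<in> M" "v = y + g \<star> z" using g Q_def by blast
    obtain y' z' where y': "y' \<in> M" "z = y' + h \<star> z'" using h Q_def by blast
    have "v = (y + g \<star> y') + (g * h) \<star> z'"
      by (simp add: y(2) y'(2) act_add_right act_mult add.assoc)
    moreover have "y + g \<star> y' \<in> M" using M y y' submoduleD by blast
    ultimately show "\<exists>y\<in>M. \<exists>z. v = y + (g * h) \<star> z" by blast
  qed
  have Qpow: "Q (g ^ n)" if "Q g" for g n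
    by (induction n) (simp_all add: Q1 Qmult that)
  have "Q (\<Prod>i\<in>I. f i ^ e i)"
    using fin f
  proof (induction I rule: finite_induct)
    case (insert i I)
    have "Q (f i)" unfolding Q_def using insert.prems by blast
    then show ?case using insert Qmult Qpow by simp
  qed (simp add: Q1)
  then show ?thesis
    unfolding Q_def using ann by (metis UNIV_eq_I add.right_neutral)
qed

text \<open>For \<open>N = \<phi>V\<close> with \<open>\<phi>\<close> irreducible, this is linear independence of the images in \<open>V/\<phi>V\<close> over
  \<open>F[x]/(\<phi>)\<close>.\<close>

primrec fresh :: "'b set \<Rightarrow> 'b list \<Rightarrow> bool"
  where
    "fresh N [] \<longleftrightarrow> True"
  | "fresh N (x # xs) \<longleftrightarrow> fresh N xs \<and> x \<notin> gen N xs"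

section \<open>Counting spans over residue fields and generating lists\<close>

lemma gen_Cons_absorb:
  assumes "submodule N" "x \<in> gen N xs"
  shows "gen N (x # xs) = gen N xs"
  using submoduleD[OF submodule_gen[OF assms(1)]] assms(2) gen_Cons_subset[of N xs x] by auto

text \<open>Modulo the old span \<open>?G\<close>, the multiplier of \<open>x\<close> matters only
  modulo \<phi>, as \<open>\<phi>V\<close> lies in \<open>?G\<close>. Distinct residues give
  distinct cosets: their difference is invertible modulo \<phi>, so otherwise \<open>x\<close> would
  lie in \<open>?G\<close>.\<close>

lemma card_gen_Cons:
  assumes N: "submodule N" and \<phi>: "irreducible \<phi>" "range (act \<phi>) \<subseteq> N" and x: "x \<notin> gen N xs"
  shows "card (gen N (x # xs)) = card (gen N xs) * card (UNIV :: 'a set) ^ degree \<phi>"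
proof -
  let ?G = "gen N xs"
  note G = submoduleD[OF submodule_gen[OF N, of xs]]
  have nz: "\<phi> \<noteq> 0" using \<phi>(1) by auto
  have \<phi>G: "\<phi> \<star> u \<in> ?G" for u
    using \<phi>(2) subset_gen[of N xs] by blast
  let ?f = "\<lambda>(r, y). r \<star> x + y"
  have "gen N (x # xs) = ?f ` (residues_mod \<phi> \<times> ?G)"
  proof (intro equalityI subsetI)
    fix v assume "v \<in> gen N (x # xs)"
    then obtain p y where y: "v = p \<star> x + y" "y \<in> ?G" by auto
    have "p \<star> x = (\<phi> * (p div \<phi>) + p mod \<phi>) \<star> x" by simp
    also have "\<dots> = \<phi> \<star> (p div \<phi>) \<star> x + (p mod \<phi>) \<star> x"
      by (simp only: act_add act_mult)
    finally have "v = ?f (p mod \<phi>, \<phi> \<star> (p div \<phi>) \<star> x + y)"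
      by (simp add: y)
    moreover have "p mod \<phi> \<in> residues_mod \<phi>" by (simp add: residues_mod_def)
    ultimately show "v \<in> ?f ` (residues_mod \<phi> \<times> ?G)"
      using G(2)[OF \<phi>G y(2)] by blast
  qed auto
  moreover have "inj_on ?f (residues_mod \<phi> \<times> ?G)"
  proof (rule inj_onI, clarify)
    fix r y s z
    assume r: "r \<in> residues_mod \<phi>" and s: "s \<in> residues_mod \<phi>" and y: "y \<in> ?G" and z: "z \<in> ?G"
      and eq: "r \<star> x + y = s \<star> x + z"
    have "(r - s) \<star> x = z - y"
      using eq by (simp add: act_diff algebra_simps)
    then have rsG: "(r - s) \<star> x \<in> ?G"
      using G(5) y z by simp
    have "r = s"
    proof (rule ccontr)
      assume "r \<noteq> s"
      then have "\<not> \<phi> dvd r - s"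
        using r s by (simp add: residues_mod_def flip: mod_eq_dvd_iff)
      then obtain a b where "a * \<phi> + b * (r - s) = 1"
        using irreducible_bezout[OF \<phi>(1)] by blast
      then have "x = (\<phi> * a + b * (r - s)) \<star> x"
        by (simp add: mult.commute)
      also have "\<dots> = \<phi> \<star> a \<star> x + b \<star> (r - s) \<star> x"
        by (simp only: act_add act_mult)
      also have "\<dots> \<in> ?G"
        using \<phi>G rsG G(2,3) by blast
      finally show False using x by blast
    qed
    then show "r = s \<and> y = z" using eq by simp
  qed
  ultimately show ?thesis
    by (simp add: card_image card_cartesian_product card_residues_mod[OF nz] mult.commute)
qed

lemma card_field_gt_1: "1 < card (UNIV :: 'a set)"
  using card_mono[of UNIV "{0, 1 :: 'a}"] by simp

text \<open>A new entry multiplies the size by \<open>Q\<close> if it lies outside the span so far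
  and by 1 otherwise. Since \<open>Q > 1\<close>, a lost factor is never regained, so maximal size
  characterises \<open>fresh\<close>.\<close>

lemma card_gen:
  assumes N: "submodule N" and \<phi>: "irreducible \<phi>" "range (act \<phi>) \<subseteq> N"
  defines "Q \<equiv> card (UNIV :: 'a set) ^ degree \<phi>"
  shows "card (gen N xs) \<le> card N * Q ^ length xs \<and>
    (card (gen N xs) = card N * Q ^ length xs \<longleftrightarrow> fresh N xs)"
proof (induction xs)
  case (Cons x xs)
  have "\<phi> \<noteq> 0" "\<not> is_unit \<phi>"
    using \<phi>(1) irreducible_not_unit by auto
  then have "degree \<phi> \<noteq> 0"
    using is_unit_iff_degree by blast
  then have Q: "1 < Q"
    unfolding Q_def using card_field_gt_1 by (intro one_less_power) auto
  have pos: "0 < card N"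
    using submoduleD(1)[OF N] by (auto simp: card_gt_0_iff)
  show ?case
  proof (cases "x \<in> gen N xs")
    case True
    have "card (gen N (x # xs)) \<le> card N * Q ^ length xs"
      using Cons gen_Cons_absorb[OF N True] by simp
    also have "\<dots> < card N * Q ^ length (x # xs)"
      using Q pos by simp
    finally show ?thesis using True by auto
  next
    case False
    then show ?thesis
      using Cons Q card_gen_Cons[OF N \<phi> False] by (simp add: Q_def[symmetric])
  qed
qed simp

text \<open>Each factor is the proportion of vectors avoiding one \<open>S i\<close>. Induction on
  the index set multiplies these proportions, as avoiding \<open>S i\<close> is independent of
  avoiding the earlier sets.\<close>

lemma card_complement_Union:
  assumes "finite I"
    and S: "\<And>i. i \<in> I \<Longrightarrow> submodule (S i)" "\<And>i. i \<in> I \<Longrightarrow> range (act (\<phi> i)) \<subseteq> S i"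
    and coprime: "\<And>i j. i \<in> I \<Longrightarrow> j \<in> I \<Longrightarrow> i \<noteq> j \<Longrightarrow> \<exists>a b. a * \<phi> i + b * \<phi> j = 1"
  shows "real (card (UNIV - (\<Union>i\<in>I. S i))) =
    real (card (UNIV :: 'b set)) * (\<Prod>i\<in>I. 1 - real (card (S i)) / real (card (UNIV :: 'b set)))"
  using assms
proof (induction I rule: finite_induct)
  case (insert i I)
  let ?n = "real (card (UNIV :: 'b set))"
  let ?\<Phi> = "\<Prod>j\<in>I. \<phi> j"
  define X where "X = UNIV - (\<Union>j\<in>I. S j)"
  have npos: "?n > 0"
    by (simp add: card_gt_0_iff)
  note Si = submoduleD[OF insert.prems(1)[OF insertI1]]
  have "card (X \<inter> S i) * card (UNIV :: 'b set) = card X * card (S i)"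
  \<comment> \<open>With \<open>?\<Phi>\<close> the product of the earlier \<open>\<phi> j\<close>,
    its range lies in every earlier \<open>S j\<close> and so preserves \<open>X\<close>. A Bezout
    identity for \<open>\<phi> i\<close> and \<open>?\<Phi>\<close> writes each vector as a sum from
    this range and \<open>S i\<close>.\<close>
  proof (rule card_inter_times_card_UNIV[where H = "range (act ?\<Phi>)"])
    show "x + h \<in> X" if x: "x \<in> X" and h: "h \<in> range (act ?\<Phi>)" for x h
    proof (rule ccontr)
      assume "x + h \<notin> X"
      then obtain j where j: "j \<in> I" "x + h \<in> S j" by (auto simp: X_def)
      obtain u where u: "h = ?\<Phi> \<star> u" using h by blast
      have "?\<Phi> = \<phi> j * prod \<phi> (I - {j})"
        using j(1) insert.hyps(1) by (rule prod.remove[rotated])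
      then have "h = \<phi> j \<star> prod \<phi> (I - {j}) \<star> u"
        by (simp add: u act_mult)
      then have "h \<in> S j" using insert.prems(2) j by blast
      then have "x + h - h \<in> S j"
        using j insert.prems(1) submoduleD(5) by blast
      then show False using x j by (auto simp: X_def)
    qed
    show "\<exists>h\<in>range (act ?\<Phi>). \<exists>s\<in>S i. v = h + s" for v
    proof -
      have "\<exists>a b. a * \<phi> i + b * ?\<Phi> = 1"
        by (rule bezout_prod) (use insert in blast)
      then obtain a b where "a * \<phi> i + b * ?\<Phi> = 1" by blast
      then have "v = (?\<Phi> * b + \<phi> i * a) \<star> v"
        by (simp add: algebra_simps)
      then have "v = ?\<Phi> \<star> b \<star> v + \<phi> i \<star> a \<star> v"
        by (simp only: act_add act_mult)
      then show ?thesis using insert.prems(2) by blast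
    qed
    show "- h \<in> range (act ?\<Phi>)" if "h \<in> range (act ?\<Phi>)" for h
      using submoduleD(4)[OF submodule_range_act that] .
  qed (use Si in auto)
  then have "real (card (X \<inter> S i)) * ?n = real (card X) * real (card (S i))"
    by (metis of_nat_mult)
  then have "real (card (X \<inter> S i)) = real (card X) * real (card (S i)) / ?n"
    using npos by (simp add: field_simps)
  moreover have "UNIV - (\<Union>j\<in>insert i I. S j) = X - X \<inter> S i"
    by (auto simp: X_def)
  moreover have "card (X - X \<inter> S i) = card X - card (X \<inter> S i)" "card (X \<inter> S i) \<le> card X"
    by (auto intro: card_Diff_subset card_mono)
  moreover have "real (card X) = ?n * (\<Prod>j\<in>I. 1 - real (card (S j)) / ?n)"
    unfolding X_def using insert.prems by (intro insert.IH) auto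
  ultimately show ?case
    using insert.hyps by (simp add: of_nat_diff algebra_simps)
qed simp

text \<open>By \<open>card\<close>, the quotient of \<open>V\<close> by the range of
  \<open>\<phi> i\<close> has dimension \<open>length xs\<close> over
  \<open>F[x]/(\<phi> i)\<close>, so there generation and independence coincide. Nakayama's lemma
  combines the quotients.\<close>

lemma gen_eq_UNIV_iff_fresh:
  assumes fin: "finite I" and irr: "\<And>i. i \<in> I \<Longrightarrow> irreducible (\<phi> i)"
    and ann: "\<And>v. (\<Prod>i\<in>I. \<phi> i ^ e i) \<star> v = 0"
    and card: "\<And>i. i \<in> I \<Longrightarrow>
      card (range (act (\<phi> i))) * (card (UNIV :: 'a set) ^ degree (\<phi> i)) ^ length xs = card (UNIV :: 'b set)"
  shows "gen {0} xs = UNIV \<longleftrightarrow> (\<forall>i\<in>I. fresh (range (act (\<phi> i))) xs)"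
proof -
  have *: "gen (range (act (\<phi> i))) xs = UNIV \<longleftrightarrow> fresh (range (act (\<phi> i))) xs" if "i \<in> I" for i
    using card_gen[OF submodule_range_act irr[OF that] order_refl, of xs] card[OF that]
    by (metis UNIV_I card_subset_eq finite_sets subset_UNIV)
  show ?thesis
  proof
    assume "gen {0} xs = UNIV"
    then have "gen (range (act (\<phi> i))) xs = UNIV" for i
      using gen_mono[of "{0}" "range (act (\<phi> i))" xs] submoduleD(1)[OF submodule_range_act] by blast
    then show "\<forall>i\<in>I. fresh (range (act (\<phi> i))) xs" using * by blast
  next
    assume "\<forall>i\<in>I. fresh (range (act (\<phi> i))) xs"
    then have "\<exists>y\<in>gen {0} xs. \<exists>z. v = y + \<phi> i \<star> z" if "i \<in> I" for i v
      using gen_decompose[of v "range (act (\<phi> i))" xs] * that by blast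
    then show "gen {0} xs = UNIV"
      by (rule nakayama[OF submodule_gen[OF submodule_0] _ fin ann])
  qed
qed

lemma card_generating_lists:
  assumes fin: "finite I" and irr: "\<And>i. i \<in> I \<Longrightarrow> irreducible (\<phi> i)"
    and coprime: "\<And>i j. i \<in> I \<Longrightarrow> j \<in> I \<Longrightarrow> i \<noteq> j \<Longrightarrow> \<exists>a b. a * \<phi> i + b * \<phi> j = 1"
    and ann: "\<And>v. (\<Prod>i\<in>I. \<phi> i ^ e i) \<star> v = 0"
    and card: "\<And>i. i \<in> I \<Longrightarrow>
      card (range (act (\<phi> i))) * (card (UNIV :: 'a set) ^ degree (\<phi> i)) ^ m = card (UNIV :: 'b set)"
  shows "real (card {xs. gen {0} xs = UNIV \<and> length xs = m}) =
    (\<Prod>k<m. real (card (UNIV :: 'b set)) *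
      (\<Prod>i\<in>I. 1 - 1 / (real (card (UNIV :: 'a set)) ^ degree (\<phi> i)) ^ (m - k)))"
proof -
  let ?N = "\<lambda>i. range (act (\<phi> i))"
  let ?Q = "\<lambda>i. card (UNIV :: 'a set) ^ degree (\<phi> i)"
  let ?n = "card (UNIV :: 'b set)"
  let ?P = "\<lambda>xs. \<forall>i\<in>I. fresh (?N i) xs"
  have "{xs. gen {0} xs = UNIV \<and> length xs = m} = {xs. ?P xs \<and> length xs = m}"
    using gen_eq_UNIV_iff_fresh[OF fin irr ann] card by blast
  moreover have "real (card {xs. ?P xs \<and> length xs = m}) =
      (\<Prod>k<m. real ?n * (\<Prod>i\<in>I. 1 - 1 / real (?Q i) ^ (m - k)))"
  proof (rule card_lists_extension[where E = "\<lambda>xs. UNIV - (\<Union>i\<in>I. gen (?N i) xs)", THEN conjunct2])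
    fix xs assume fresh: "?P xs" and len: "length xs < m"
    have sub: "?N i \<subseteq> gen (?N i) xs" for i
      by (rule subset_gen)
    \<comment> \<open>A fresh list of length \<open>k\<close> leaves a quotient of dimension
      \<open>m - k\<close> over the residue field, so its span has index
      \<open>?Q i ^ (m - k)\<close>.\<close>
    have "real (card (gen (?N i) xs)) / real ?n = 1 / real (?Q i) ^ (m - length xs)" if i: "i \<in> I" for i
    proof -
      have "card (gen (?N i) xs) = card (?N i) * ?Q i ^ length xs"
        using card_gen[OF submodule_range_act irr[OF i] order_refl, of xs] fresh i by blast
      then have "card (gen (?N i) xs) * ?Q i ^ (m - length xs) = ?n"
        using card[OF i] len by (simp add: mult.assoc flip: power_add)
      then have "real (card (gen (?N i) xs)) * real (?Q i) ^ (m - length xs) = real ?n"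
        by (metis of_nat_mult of_nat_power)
      moreover have "?n > 0" "?Q i > 0" by (simp_all add: card_gt_0_iff)
      ultimately show ?thesis by (simp add: field_simps)
    qed
    then show "real (card (UNIV - (\<Union>i\<in>I. gen (?N i) xs))) =
        real ?n * (\<Prod>i\<in>I. 1 - 1 / real (?Q i) ^ (m - length xs))"
      using card_complement_Union[OF fin submodule_gen[OF submodule_range_act] sub coprime]
      by simp
  qed auto
  ultimately show ?thesis by simp
qed

subsection \<open>Ordered bases and splitting subspaces\<close>

lemma card_span_independent:
  assumes "independent B"
  shows "card (span B) = card (UNIV :: 'a set) ^ card B"
proof -
  have "finite B" by simp
  then show ?thesis using assms
  proof (induction B rule: finite_induct)
    case (insert a B)
    have a: "a \<notin> span B" and B: "independent B"
      using insert.prems insert.hyps by (simp_all add: independent_insert)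
    let ?f = "\<lambda>(k, y). scale k a + y"
    have "span (insert a B) = ?f ` (UNIV \<times> span B)"
    proof (intro equalityI subsetI)
      fix v assume "v \<in> span (insert a B)"
      then obtain k where "v - scale k a \<in> span B" by (auto simp: span_insert)
      then show "v \<in> ?f ` (UNIV \<times> span B)"
        by (intro image_eqI[of _ _ "(k, v - scale k a)"]) auto
    next
      fix v assume "v \<in> ?f ` (UNIV \<times> span B)"
      then obtain k y where "v = scale k a + y" "y \<in> span B" by auto
      then have "v - scale k a \<in> span B" by simp
      then show "v \<in> span (insert a B)"
        unfolding span_insert by blast
    qed
    moreover have "inj_on ?f (UNIV \<times> span B)"
    proof (rule inj_onI, clarify)
      fix k l y z assume y: "y \<in> span B" and z: "z \<in> span B" and eq: "scale k a + y = scale l a + z"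
      have "scale (k - l) a = z - y"
        using eq unfolding scale_left_diff_distrib by (metis add_diff_cancel_left' diff_add_eq diff_diff_eq2)
      then have *: "scale (k - l) a \<in> span B"
        using span_diff[OF z y] by simp
      have "k = l"
      proof (rule ccontr)
        assume "k \<noteq> l"
        then have "scale (inverse (k - l)) (scale (k - l) a) = a" by simp
        then show False using span_scale[OF *, of "inverse (k - l)"] a by simp
      qed
      then show "k = l \<and> y = z" using eq by simp
    qed
    ultimately show ?case
      using insert.IH[OF B] insert.hyps by (simp add: card_image card_cartesian_product)
  qed simp
qed

lemma card_subspace:
  assumes "subspace W"
  shows "card W = card (UNIV :: 'a set) ^ dim W"
proof -
  obtain B where B: "B \<subseteq> W" "independent B" "W \<subseteq> span B" "card B = dim W"
    using basis_exists by blast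
  then have "span B = W"
    using assms span_minimal by blast
  then show ?thesis using card_span_independent[OF B(2)] B(4) by simp
qed

definition ordered_basis :: "'b set \<Rightarrow> 'b list \<Rightarrow> bool"
  where "ordered_basis W xs \<longleftrightarrow> distinct xs \<and> independent (set xs) \<and> span (set xs) = W"

text \<open>Spanning \<open>W\<close> does not pass to tails, so it is replaced by containment in
  \<open>W\<close>; at length \<open>m\<close> cardinality restores it. After \<open>k\<close>
  vectors, the next one avoids a span of size \<open>q ^ k\<close>.\<close>

lemma card_ordered_bases:
  assumes W: "subspace W" "dim W = m"
  shows "real (card {xs. ordered_basis W xs \<and> length xs = m}) = gamma_q (real (card (UNIV :: 'a set))) m"
proof -
  let ?q = "card (UNIV :: 'a set)"
  let ?P = "\<lambda>xs. distinct xs \<and> independent (set xs) \<and> set xs \<subseteq> W"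
  have cardW: "card W = ?q ^ m"
    using card_subspace W by simp
  have span_sub: "span (set xs) \<subseteq> W" if "?P xs" for xs
    using that W span_minimal by blast
  have card_span: "card (span (set xs)) = ?q ^ length xs" if "?P xs" for xs
    using that card_span_independent by (simp add: distinct_card)
  have "span (set xs) = W" if "?P xs" "length xs = m" for xs
    using card_span[OF that(1)] that(2) cardW by (intro card_subset_eq span_sub that) simp_all
  then have "{xs. ordered_basis W xs \<and> length xs = m} = {xs. ?P xs \<and> length xs = m}"
    unfolding ordered_basis_def using span_superset by blast
  moreover have "real (card {xs. ?P xs \<and> length xs = m}) = (\<Prod>k<m. real ?q ^ m - real ?q ^ k)"
  proof (rule card_lists_extension[where E = "\<lambda>xs. W - span (set xs)", THEN conjunct2])
    show "?P (x # xs) \<longleftrightarrow> ?P xs \<and> x \<in> W - span (set xs)" for x xs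
      using span_base[of x "set xs"] by (auto simp: independent_insert split: if_splits)
    show "real (card (W - span (set xs))) = real ?q ^ m - real ?q ^ length xs"
      if P: "?P xs" and len: "length xs < m" for xs
    proof -
      have "card (W - span (set xs)) = ?q ^ m - ?q ^ length xs"
        using card_Diff_subset[OF _ span_sub[OF P]] card_span[OF P] cardW by simp
      moreover have "?q ^ length xs \<le> ?q ^ m"
        using card_field_gt_1 len by (intro power_increasing) auto
      ultimately show ?thesis by (simp add: of_nat_diff)
    qed
  qed (use independent_empty in auto)
  ultimately show ?thesis by (simp add: gamma_q_def)
qed

lemma power_T_submodule:
  assumes "submodule S" "x \<in> S"
  shows "(T ^^ k) x \<in> S"
proof (induction k)
  case (Suc k)
  then show ?case using submoduleD(3)[OF assms(1) Suc, of "[:0, 1:]"] by (simp add: act_X)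
qed (simp add: assms)

text \<open>As \<open>p\<close> annihilates \<open>V\<close>, each \<open>f \<star> x\<close>
  depends only on \<open>f mod p\<close>, so the generated submodule is the sum of the
  \<open>T ^^ i\<close> images of the span for \<open>i < d\<close>. The size of \<open>V\<close>
  leaves no slack: if that sum is everything, the list is independent and the sum is direct.\<close>

lemma gen_eq_UNIV_iff_splitting:
  assumes d: "degree p = d" "d \<ge> 1" and ann: "\<And>v. p \<star> v = 0"
    and card: "card (UNIV :: 'b set) = card (UNIV :: 'a set) ^ (m * d)"
    and len: "length xs = m"
  shows "gen {0} xs = UNIV \<longleftrightarrow>
    ordered_basis (span (set xs)) xs \<and> splitting_subspace scale T m d (span (set xs))"
proof
  let ?W = "span (set xs)"
  let ?q = "card (UNIV :: 'a set)"
  let ?F = "\<Pi>\<^sub>E i\<in>{..<d}. (T ^^ i) ` ?W"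
  let ?s = "\<lambda>w. \<Sum>i<d. w i"
  assume gen: "gen {0} xs = UNIV"
  \<comment> \<open>\<open>Z\<close> is the sum of the images of \<open>?W\<close> under the powers
    of \<open>T\<close> below \<open>d\<close>.\<close>
  define Z where "Z = {\<Sum>i<d. (T ^^ i) (u i) | u. \<forall>i. u i \<in> ?W}"
  have Z_add: "y + z \<in> Z" if yz: "y \<in> Z" "z \<in> Z" for y z
  proof -
    obtain u u' where "y = (\<Sum>i<d. (T ^^ i) (u i))" "z = (\<Sum>i<d. (T ^^ i) (u' i))"
      "\<forall>i. u i \<in> ?W" "\<forall>i. u' i \<in> ?W"
      using yz by (auto simp: Z_def)
    then show ?thesis
      unfolding Z_def
      by (intro CollectI exI[of _ "\<lambda>i. u i + u' i"]) (simp add: power_T_add sum.distrib span_add)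
  qed
  have Z_act: "f \<star> x \<in> Z" if x: "x \<in> ?W" for f x
  proof -
    have p: "p \<noteq> 0" "degree p \<noteq> 0" using d by auto
    \<comment> \<open>A zero remainder has degree 0, which is below \<open>d\<close> because
      \<open>d \<ge> 1\<close>.\<close>
    then have deg: "degree (f mod p) < d"
      using degree_mod_less'[of p f] d(1) by (cases "f mod p = 0") auto
    have "f \<star> x = (p * (f div p) + f mod p) \<star> x" by simp
    also have "\<dots> = (f mod p) \<star> x"
      by (simp only: act_add act_mult ann add_0)
    also have "\<dots> = (\<Sum>k\<le>d - 1. scale (coeff (f mod p) k) ((T ^^ k) x))"
      using deg by (intro act_eq) simp
    also have "{..d - 1} = {..<d}" using d(2) by auto
    finally have "f \<star> x = (\<Sum>k<d. (T ^^ k) (scale (coeff (f mod p) k) x))"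
      by (simp add: power_T_scale)
    then show ?thesis
      unfolding Z_def using span_scale[OF x] by (intro CollectI exI[of _ "\<lambda>k. scale (coeff (f mod p) k) x"]) simp
  qed
  have "gen {0} ys \<subseteq> Z" if "set ys \<subseteq> ?W" for ys
    using that
  proof (induction ys)
    case Nil
    show ?case using Z_act[OF span_zero, of 0] by simp
  next
    case (Cons y ys)
    then show ?case using Z_add Z_act by auto
  qed
  then have Z: "Z = UNIV"
    using gen span_superset by blast
  have surj: "?s ` ?F = UNIV"
  proof -
    have "v \<in> ?s ` ?F" for v
    proof -
      have "v \<in> Z" using Z by simp
      then obtain u where u: "v = (\<Sum>i<d. (T ^^ i) (u i))" "\<forall>i. u i \<in> ?W"
        by (auto simp: Z_def)
      then show ?thesis
        by (intro image_eqI[of _ _ "\<lambda>i\<in>{..<d}. (T ^^ i) (u i)"]) auto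
    qed
    then show ?thesis by blast
  qed
  have finF: "finite ?F" by (rule finite_PiE) auto
  have "card ?F = (\<Prod>i<d. card ((T ^^ i) ` ?W))"
    by (rule card_PiE) simp
  also have "\<dots> \<le> (\<Prod>i<d. card ?W)"
    by (intro prod_mono) (auto intro: card_image_le)
  also have "\<dots> = ?q ^ (dim ?W * d)"
    using card_subspace[OF subspace_span, of "set xs"] by (simp add: power_mult)
  finally have Fle: "card ?F \<le> ?q ^ (dim ?W * d)" .
  have UNIVle: "?q ^ (m * d) \<le> card ?F"
    using card_image_le[OF finF, of ?s] surj card by simp
  \<comment> \<open>\<open>V\<close> is an image of \<open>?F\<close>, and each factor of
    \<open>?F\<close> has at most as many elements as \<open>?W\<close>; the exponents of
    \<open>?q\<close> are compared.\<close>
  have "m * d \<le> dim ?W * d"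
    using UNIVle Fle card_field_gt_1 by (meson le_trans power_le_imp_le_exp)
  then have "m \<le> dim ?W" using d(2) by simp
  \<comment> \<open>A basis chosen among the entries has at least \<open>m\<close> elements, while
    \<open>xs\<close> has length \<open>m\<close>; so the entries are distinct and all of them
    belong to the basis.\<close>
  obtain B where B: "B \<subseteq> set xs" "independent B" "set xs \<subseteq> span B" "card B = dim (set xs)"
    using basis_exists by blast
  have "card B \<le> card (set xs)" "card (set xs) \<le> m"
    using B(1) len card_length[of xs] by (auto intro: card_mono)
  then have cards: "card B = m" "card (set xs) = m" and dim: "dim ?W = m"
    using \<open>m \<le> dim ?W\<close> B(4) by (auto simp: dim_span)
  have "B = set xs"
    using card_subset_eq[OF _ B(1)] cards by simp
  then have "ordered_basis ?W xs"
    using B(2) cards(2) len by (simp add: ordered_basis_def card_distinct)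
  moreover have "splitting_subspace scale T m d ?W"
    unfolding splitting_subspace_def
  proof (intro conjI allI)
    \<comment> \<open>A surjection between finite sets of equal size is injective, which gives
      uniqueness of the decomposition.\<close>
    have "card ?F = card (UNIV :: 'b set)"
      using UNIVle Fle dim card by simp
    then have "inj_on ?s ?F"
      using surj by (intro eq_card_imp_inj_on[OF finF]) simp
    moreover have "v \<in> ?s ` ?F" for v using surj by simp
    ultimately show "\<exists>!w. w \<in> ?F \<and> v = ?s w" for v
      unfolding inj_on_def by (smt (verit, best) imageE)
  qed (use dim in auto)
  ultimately show "ordered_basis ?W xs \<and> splitting_subspace scale T m d ?W" by blast
next
  assume "ordered_basis (span (set xs)) xs \<and> splitting_subspace scale T m d (span (set xs))"
  then have split: "\<exists>w. w \<in> (\<Pi>\<^sub>E i\<in>{..<d}. (T ^^ i) ` span (set xs)) \<and> v = (\<Sum>i<d. w i)" for v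
    unfolding splitting_subspace_def by blast
  have sub: "submodule (gen {0} xs)"
    by (rule submodule_gen[OF submodule_0])
  have span: "span (set xs) \<subseteq> gen {0} xs"
    by (rule span_minimal[OF set_subset_gen[OF submodule_0] submodule_imp_subspace[OF sub]])
  show "gen {0} xs = UNIV"
  proof (intro equalityI subset_UNIV subsetI)
    fix v :: 'b
    obtain w where w: "w \<in> (\<Pi>\<^sub>E i\<in>{..<d}. (T ^^ i) ` span (set xs))" "v = (\<Sum>i<d. w i)"
      using split by blast
    have "w i \<in> gen {0} xs" if "i < d" for i
    proof -
      have "w i \<in> (T ^^ i) ` span (set xs)" using PiE_mem[OF w(1)] that by simp
      then obtain x where "w i = (T ^^ i) x" "x \<in> span (set xs)" by blast
      then show ?thesis using span power_T_submodule[OF sub, of x i] by auto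
    qed
    then show "v \<in> gen {0} xs"
      unfolding w(2) by (intro subspace_sum submodule_imp_subspace sub) auto
  qed
qed

text \<open>Each generating list is an ordered basis of exactly one splitting subspace, namely its
  span, so the generating lists are partitioned into sets of \<open>\<gamma>\<^sub>q(m)\<close>
  bases.\<close>

lemma num_splitting_subspaces_times_gamma_q:
  assumes d: "degree p = d" "d \<ge> 1" and ann: "\<And>v. p \<star> v = 0"
    and card: "card (UNIV :: 'b set) = card (UNIV :: 'a set) ^ (m * d)"
  shows "real (num_splitting_subspaces scale T m d) * gamma_q (real (card (UNIV :: 'a set))) m =
    real (card {xs. gen {0} xs = UNIV \<and> length xs = m})"
proof -
  let ?S = "{W. splitting_subspace scale T m d W}"
  let ?B = "\<lambda>W. {xs. ordered_basis W xs \<and> length xs = m}"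
  have "gen {0} xs = UNIV \<and> length xs = m \<longleftrightarrow> (\<exists>W\<in>?S. xs \<in> ?B W)" for xs
    using gen_eq_UNIV_iff_splitting[OF d ann card] by (auto simp: ordered_basis_def)
  then have "{xs. gen {0} xs = UNIV \<and> length xs = m} = (\<Union>W\<in>?S. ?B W)"
    by blast
  moreover have "card (\<Union>W\<in>?S. ?B W) = (\<Sum>W\<in>?S. card (?B W))"
  proof (rule card_UN_disjoint)
    have "finite (UNIV :: 'b set set)"
      by (metis Pow_UNIV finite_Pow_iff finite_space)
    then show "finite ?S" by (rule finite_subset[OF subset_UNIV])
    have "finite {xs :: 'b list. set xs \<subseteq> UNIV \<and> length xs = m}"
      by (rule finite_lists_length_eq) simp
    then show "\<forall>W\<in>?S. finite (?B W)"
      by (auto intro: rev_finite_subset)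
  qed (auto simp: ordered_basis_def)
  moreover have "real (\<Sum>W\<in>?S. card (?B W)) = (\<Sum>W\<in>?S. gamma_q (real (card (UNIV :: 'a set))) m)"
    unfolding of_nat_sum
    by (intro sum.cong refl card_ordered_bases) (auto simp: splitting_subspace_def)
  ultimately show ?thesis
    by (simp add: num_splitting_subspaces_def)
qed

subsection \<open>Torsion in direct sums of cyclic modules\<close>

context
  fixes I :: "'i set" and g :: "'i \<Rightarrow> 'a poly" and \<psi> :: "'b \<Rightarrow> 'i \<Rightarrow> 'a poly"
  assumes bij: "bij_betw \<psi> UNIV (\<Pi>\<^sub>E i\<in>I. residues_mod (g i))"
    and \<psi>_act: "\<And>p v i. i \<in> I \<Longrightarrow> \<psi> (p \<star> v) i = (p * \<psi> v i) mod g i"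
begin

lemma act_eq_0_iff: "p \<star> v = 0 \<longleftrightarrow> (\<forall>i\<in>I. g i dvd p * \<psi> v i)"
proof -
  \<comment> \<open>Apply compatibility with the action to the zero polynomial.\<close>
  have \<psi>0: "\<psi> 0 i = 0" if "i \<in> I" for i
    using \<psi>_act[OF that, of 0 0] by simp
  have mem: "\<psi> u \<in> (\<Pi>\<^sub>E i\<in>I. residues_mod (g i))" for u
    using bij by (auto simp: bij_betw_def)
  have "p \<star> v = 0 \<longleftrightarrow> \<psi> (p \<star> v) = \<psi> 0"
    using bij by (metis UNIV_I bij_betw_imp_inj_on inj_onD)
  also have "\<dots> \<longleftrightarrow> (\<forall>i\<in>I. \<psi> (p \<star> v) i = \<psi> 0 i)"
    using PiE_ext[OF mem mem] by metis
  finally show ?thesis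
    by (simp add: \<psi>0 \<psi>_act dvd_eq_mod_eq_0)
qed

text \<open>Annihilation by \<open>p\<close> is tested in each component, so \<psi> carries the
  torsion onto the product of the torsion sets of the summands.\<close>

lemma card_torsion:
  assumes "finite I"
  shows "card {v. p \<star> v = 0} = (\<Prod>i\<in>I. card {r \<in> residues_mod (g i). g i dvd p * r})"
proof -
  have mem: "\<psi> u \<in> (\<Pi>\<^sub>E i\<in>I. residues_mod (g i))" for u
    using bij by (auto simp: bij_betw_def)
  have "\<psi> ` {v. p \<star> v = 0} = (\<Pi>\<^sub>E i\<in>I. {r \<in> residues_mod (g i). g i dvd p * r})" (is "_ = ?R")
  proof (intro equalityI subsetI)
    fix w assume "w \<in> \<psi> ` {v. p \<star> v = 0}"
    then obtain v where "w = \<psi> v" "\<forall>i\<in>I. g i dvd p * \<psi> v i"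
      using act_eq_0_iff by blast
    then show "w \<in> ?R"
      using mem[of v] by (simp add: PiE_iff)
  next
    fix w assume w: "w \<in> ?R"
    then have "w \<in> (\<Pi>\<^sub>E i\<in>I. residues_mod (g i))" by (simp add: PiE_iff)
    then have "w \<in> range \<psi>"
      using bij by (simp add: bij_betw_def)
    then obtain v where "w = \<psi> v" by blast
    then show "w \<in> \<psi> ` {v. p \<star> v = 0}"
      using w act_eq_0_iff by (simp add: PiE_iff)
  qed
  moreover have "inj_on \<psi> {v. p \<star> v = 0}"
    using bij by (auto simp: bij_betw_def inj_on_def)
  ultimately have "card {v. p \<star> v = 0} = card ?R"
    using card_image by metis
  then show ?thesis by (simp add: card_PiE[OF assms])
qed

end

end

subsection \<open>The number of splitting subspaces\<close>

theorem theorem3p8: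
  fixes scale :: "'a::{field,finite} \<Rightarrow> 'b::ab_group_add \<Rightarrow> 'b"
    and T :: "'b \<Rightarrow> 'b" and m d :: nat and \<tau> :: "(nat \<times> nat list) multiset" and q :: real
  assumes "vector_space scale"
    and "m \<ge> 1" and "d \<ge> 1"
    and "vector_space.dim scale (UNIV :: 'b set) = m * d"
    and "Vector_Spaces.linear scale scale T"
    and "has_similarity_class_type scale T \<tau>"
    and "(\<Sum>(e, lam)\<in>#\<tau>. e * part lam m) = d"
    and "q = real (card (UNIV :: 'a set))"
  shows "real (num_splitting_subspaces scale T m d) =
    q ^ (m\<^sup>2 * d) / gamma_q q m *
      (\<Prod>(e, lam)\<in>#\<tau>. \<Prod>j=1..m. 1 - q powi (- int (j * e)))"
proof -
  obtain t :: nat and \<phi> lam where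
    \<phi>: "\<And>i. i \<in> {1..t} \<Longrightarrow> irreducible (\<phi> i)" "\<And>i. i \<in> {1..t} \<Longrightarrow> lead_coeff (\<phi> i) = 1"
      "inj_on \<phi> {1..t}"
    and lam: "\<And>i. i \<in> {1..t} \<Longrightarrow> is_partition (lam i)" "\<And>i. i \<in> {1..t} \<Longrightarrow> lam i \<noteq> []"
    and iso: "poly_module_iso_direct_sum scale T
          (SIGMA i:{1..t}. {1..length (lam i)}) (\<lambda>(i, j). \<phi> i ^ part (lam i) j)"
    and \<tau>: "\<tau> = image_mset (\<lambda>i. (degree (\<phi> i), lam i)) (mset_set {1..t})"
    using assms(6) unfolding has_similarity_class_type_def by blast
  let ?I = "SIGMA i:{1..t}. {1..length (lam i)}"
  let ?q = "card (UNIV :: 'a set)"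
  let ?n = "card (UNIV :: 'b set)"
  define g where "g = (\<lambda>(i, j). \<phi> i ^ part (lam i) j)"
  obtain \<psi> where bij: "bij_betw \<psi> UNIV (\<Pi>\<^sub>E k\<in>?I. residues_mod (g k))"
    and \<psi>_act: "\<And>p v k. k \<in> ?I \<Longrightarrow> \<psi> (poly_act scale T p v) k = (p * \<psi> v k) mod g k"
    using iso unfolding poly_module_iso_direct_sum_def g_def by blast
  have nz: "\<phi> i \<noteq> 0" "degree (\<phi> i) > 0" if "i \<in> {1..t}" for i
  proof -
    show "\<phi> i \<noteq> 0" using \<phi>(1)[OF that] by auto
    then show "degree (\<phi> i) > 0"
      using irreducible_not_unit[OF \<phi>(1)[OF that]] is_unit_iff_degree by blast
  qed
  have g_nz: "g k \<noteq> 0" if "k \<in> ?I" for k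
    using that nz by (auto simp: g_def)
  \<comment> \<open>Finiteness of \<open>V\<close> comes from the isomorphism with finitely many
    finite residue rings.\<close>
  have "finite (\<Pi>\<^sub>E k\<in>?I. residues_mod (g k))"
    by (intro finite_PiE finite_residues_mod g_nz) auto
  then have "finite (UNIV :: 'b set)"
    using bij bij_betw_finite by blast
  then interpret finite_operator scale T
    using assms(1,5) by (simp add: finite_operator_def finite_operator_axioms_def)
  have n: "?n = ?q ^ (m * d)"
    using card_subspace[OF subspace_UNIV] assms(4) by simp
  \<comment> \<open>Comparing this count of \<open>V\<close> with the one from its dimension shows
    that \<tau> has size \<open>m * d\<close>.\<close>
  have "?n = (\<Prod>k\<in>?I. card (residues_mod (g k)))"
    using bij_betw_same_card[OF bij] by (simp add: card_PiE)
  also have "\<dots> = (\<Prod>k\<in>?I. ?q ^ degree (g k))"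
    by (intro prod.cong refl card_residues_mod g_nz)
  also have "\<dots> = ?q ^ (\<Sum>k\<in>?I. degree (g k))"
    by (simp add: power_sum)
  finally have "m * d = (\<Sum>k\<in>?I. degree (g k))"
    using n card_field_gt_1 by (metis power_inject_exp)
  also have "\<dots> = (\<Sum>i\<in>{1..t}. \<Sum>j\<in>{1..length (lam i)}. part (lam i) j * degree (\<phi> i))"
    by (subst sum.Sigma) (auto simp: g_def degree_power_eq nz intro!: sum.cong)
  finally have size: "m * d =
      (\<Sum>i\<in>{1..t}. degree (\<phi> i) * (\<Sum>j\<in>{1..length (lam i)}. part (lam i) j))"
    by (simp add: sum_distrib_left mult.commute)
  have dsum: "d = (\<Sum>i\<in>{1..t}. degree (\<phi> i) * part (lam i) m)"
    using assms(7) by (simp add: \<tau> multiset.map_comp comp_def flip: sum_unfold_sum_mset)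
  \<comment> \<open>Both sums equal \<open>m * d\<close>. By \<open>sum_parts_ge\<close> each term
    on the left is at most the one on the right, so equality holds for every
    \<open>i\<close>.\<close>
  then have "(\<Sum>i\<in>{1..t}. degree (\<phi> i) * (m * part (lam i) m)) =
      (\<Sum>i\<in>{1..t}. degree (\<phi> i) * (\<Sum>j\<in>{1..length (lam i)}. part (lam i) j))"
    using size by (simp add: sum_distrib_left mult_ac)
  then have eq: "degree (\<phi> i) * (m * part (lam i) m) =
      degree (\<phi> i) * (\<Sum>j\<in>{1..length (lam i)}. part (lam i) j)" if "i \<in> {1..t}" for i
    by (rule sum_mono_inv[OF _ mult_left_mono[OF sum_parts_ge(1)[OF lam assms(2)]] that]) simp_all
  have rect: "length (lam i) = m" "\<And>j. j \<in> {1..m} \<Longrightarrow> part (lam i) j = part (lam i) m"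
    "part (lam i) m > 0" if i: "i \<in> {1..t}" for i
  proof -
    have "m * part (lam i) m = (\<Sum>j=1..length (lam i). part (lam i) j)"
      using eq[OF i] nz[OF i] by simp
    then show *: "length (lam i) = m" "\<And>j. j \<in> {1..m} \<Longrightarrow> part (lam i) j = part (lam i) m"
      using sum_parts_ge(2)[OF lam(1)[OF i] lam(2)[OF i] assms(2)] by blast+
    show "part (lam i) m > 0"
      using part_pos[OF lam(1)[OF i], of m] *(1) assms(2) by simp
  qed
  define e where "e i = part (lam i) m" for i
  define p where "p = (\<Prod>i\<in>{1..t}. \<phi> i ^ e i)"
  have I: "?I = {1..t} \<times> {1..m}"
    using rect(1) by auto
  have g: "g (i, j) = \<phi> i ^ e i" if "i \<in> {1..t}" "j \<in> {1..m}" for i j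
    unfolding g_def e_def using rect(2)[OF that] by simp
  have coprime: "\<exists>a b. a * \<phi> i + b * \<phi> j = 1" if "i \<in> {1..t}" "j \<in> {1..t}" "i \<noteq> j" for i j
    by (intro monic_irreducible_bezout \<phi>(1,2) that) (use inj_onD[OF \<phi>(3)] that in blast)
  have deg_p: "degree p = d"
  proof -
    have "degree p = (\<Sum>i\<in>{1..t}. degree (\<phi> i ^ e i))"
      unfolding p_def using nz(1) by (intro degree_prod_eq_sum_degree) simp
    also have "\<dots> = d"
      unfolding dsum e_def using nz(1) by (intro sum.cong) (simp_all add: degree_power_eq)
    finally show ?thesis .
  qed
  \<comment> \<open>All parts of \<open>lam i\<close> equal \<open>e i\<close>, so the modulus of
    every summand divides \<open>p\<close>.\<close>
  have ann: "poly_act scale T p v = 0" for v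
  proof (subst act_eq_0_iff[OF bij \<psi>_act], assumption, rule)
    fix k assume "k \<in> ?I"
    then obtain i j where "k = (i, j)" "i \<in> {1..t}" "j \<in> {1..m}" using I by auto
    then have "g k dvd p"
      unfolding p_def using g[of i j] dvd_prodI[of "{1..t}" i "\<lambda>i. \<phi> i ^ e i"] by simp
    then show "g k dvd p * \<psi> v k" by simp
  qed
  \<comment> \<open>Only the \<open>m\<close> summands belonging to \<open>\<phi> i\<close> itself
    have nonzero torsion under it, with \<open>?q ^ degree (\<phi> i)\<close> elements each; on the
    others \<open>\<phi> i\<close> is invertible. The range is then measured through the
    kernel.\<close>
  have card_range: "card (range (poly_act scale T (\<phi> i))) * (?q ^ degree (\<phi> i)) ^ m = ?n"
    if i: "i \<in> {1..t}" for i
  proof -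
    have "card {v. poly_act scale T (\<phi> i) v = 0} =
        (\<Prod>k\<in>?I. card {r \<in> residues_mod (g k). g k dvd \<phi> i * r})"
      by (rule card_torsion[OF bij \<psi>_act]) auto
    also have "\<dots> = (\<Prod>i'\<in>{1..t}. \<Prod>j\<in>{1..m}. card {r \<in> residues_mod (g (i', j)). g (i', j) dvd \<phi> i * r})"
      unfolding I by (simp add: prod.cartesian_product)
    also have "\<dots> = (\<Prod>i'\<in>{1..t}. \<Prod>j\<in>{1..m}. if i' = i then ?q ^ degree (\<phi> i) else 1)"
    proof (intro prod.cong refl)
      fix i' j assume i': "i' \<in> {1..t}" and j: "j \<in> {1..m}"
      obtain l where l: "e i' = Suc l"
        using rect(3)[OF i'] unfolding e_def by (metis gr0_implies_Suc)
      show "card {r \<in> residues_mod (g (i', j)). g (i', j) dvd \<phi> i * r} =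
          (if i' = i then ?q ^ degree (\<phi> i) else 1)"
      proof (cases "i' = i")
        case True
        then show ?thesis
          unfolding g[OF i' j] l using card_residues_mod_torsion[OF nz(1)[OF i], of l] by simp
      next
        case False
        then show ?thesis
          unfolding g[OF i' j]
          using residues_mod_torsion_coprime[OF bezout_power[OF coprime[OF i i']], of "e i'"] by simp
      qed
    qed
    also have "\<dots> = (\<Prod>i'\<in>{1..t}. if i' = i then (?q ^ degree (\<phi> i)) ^ m else 1)"
      by (intro prod.cong refl) auto
    also have "\<dots> = (?q ^ degree (\<phi> i)) ^ m"
      using i by simp
    finally have "card {v. poly_act scale T (\<phi> i) v = 0} = (?q ^ degree (\<phi> i)) ^ m" .
    then show ?thesis
      using card_kernel_times_card_range[OF finite_space, of "poly_act scale T (\<phi> i)", OF act_add_right]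
      by (simp add: mult.commute)
  qed
  have q: "q > 1"
    using card_field_gt_1 assms(8) by simp
  have gamma: "gamma_q q m \<noteq> 0"
    unfolding gamma_q_def using q by (simp add: power_inject_exp)
  have "real (num_splitting_subspaces scale T m d) * gamma_q q m =
      real (card {xs. gen {0} xs = UNIV \<and> length xs = m})"
    unfolding assms(8) by (rule num_splitting_subspaces_times_gamma_q[OF deg_p assms(3) ann n])
  also have "\<dots> = (\<Prod>k<m. real ?n * (\<Prod>i\<in>{1..t}. 1 - 1 / (q ^ degree (\<phi> i)) ^ (m - k)))"
    unfolding assms(8)
    by (rule card_generating_lists[OF _ \<phi>(1) coprime _ card_range]) (use ann p_def in auto)
  also have "\<dots> = real ?n ^ m * (\<Prod>i\<in>{1..t}. \<Prod>k<m. 1 - 1 / (q ^ degree (\<phi> i)) ^ (m - k))"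
    unfolding prod.distrib by (subst (2) prod.swap) simp
  also have "real ?n ^ m = q ^ (m\<^sup>2 * d)"
    by (simp add: n assms(8) power2_eq_square mult_ac flip: power_mult)
  also have "(\<Prod>i\<in>{1..t}. \<Prod>k<m. 1 - 1 / (q ^ degree (\<phi> i)) ^ (m - k)) =
      (\<Prod>i\<in>{1..t}. \<Prod>j=1..m. 1 - q powi (- int (j * degree (\<phi> i))))"
  proof (rule prod.cong[OF refl])
    fix i
    \<comment> \<open>Reindexing by \<open>j = m - k\<close>: the form
      \<open>Suc (m - Suc k)\<close> is used because \<open>m - Suc k\<close> runs through
      \<open>{..<m}\<close> backwards.\<close>
    have "(\<Prod>k<m. 1 - 1 / (q ^ degree (\<phi> i)) ^ (m - k)) =
        (\<Prod>k<m. 1 - 1 / (q ^ degree (\<phi> i)) ^ Suc (m - Suc k))"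
      by (intro prod.cong refl) (simp add: Suc_diff_Suc)
    also have "\<dots> = (\<Prod>k<m. 1 - 1 / (q ^ degree (\<phi> i)) ^ Suc k)"
      by (rule prod.nat_diff_reindex)
    also have "\<dots> = (\<Prod>j=1..m. 1 - 1 / (q ^ degree (\<phi> i)) ^ j)"
      by (simp add: prod.atLeast1_atMost_eq)
    also have "\<dots> = (\<Prod>j=1..m. 1 - q powi (- int (j * degree (\<phi> i))))"
      by (intro prod.cong refl)
        (simp only: power_int_minus power_int_of_nat inverse_eq_divide mult.commute flip: power_mult)
    finally show "(\<Prod>k<m. 1 - 1 / (q ^ degree (\<phi> i)) ^ (m - k)) =
        (\<Prod>j=1..m. 1 - q powi (- int (j * degree (\<phi> i))))" .
  qed
  also have "\<dots> = (\<Prod>(e, lam)\<in>#\<tau>. \<Prod>j=1..m. 1 - q powi (- int (j * e)))"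
    by (simp add: \<tau> multiset.map_comp comp_def prod_unfold_prod_mset)
  finally show ?thesis
    using gamma by (simp add: field_simps)
qed

end
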